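(* Let $1\le p_1<p_2<\infty$. Then $\mathscr{M}(d_{p_1})\subsetneq\mathscr{M}(d_{p_2})$. In particular, $d_1\subseteq\mathscr{M}(d_p)$ for all $1\le p<\infty$.
   Context: Let $\mathbb{N}_0=\{0,1,2,\dots\}$. For $p\in[1,\infty)$, $d_p$ is the Banach space of all complex sequences $a=(a_n)_{n=0}^\infty$ with $\|a\|_{d_p}:=\big(\sum_{n=0}^\infty\sup_{k\ge n}|a_k|^p\big)^{1/p}<\infty$. The convolution of $a,b\in\mathbb{C}^{\mathbb{N}_0}$ is $(a*b)_n:=\sum_{j=0}^n a_jb_{n-j}$, $n\in\mathbb{N}_0$. The multiplier algebra of $d_p$ is $\mathscr{M}(d_p):=\{b\in\mathbb{C}^{\mathbb{N}_0}: a*b\in d_p \text{ for all } a\in d_p\}$. *)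

theory Defs
  imports "HOL-Analysis.Analysis"
begin

text \<open>
  Sums and suprema are taken in \<^typ>\<open>ennreal\<close>, so that they exist for every complex sequence
  and finiteness is a genuine condition. The power \<open>1 / p\<close> is extended to \<open>\<infinity>\<close> by
  \<open>\<infinity>\<close>, as no power function is available on \<^typ>\<open>ennreal\<close>.
\<close>

definition d_sum :: "real \<Rightarrow> (nat \<Rightarrow> complex) \<Rightarrow> ennreal" where
  "d_sum p a = (\<Sum>n. SUP k\<in>{n..}. ennreal (cmod (a k) powr p))"

definition d_norm :: "real \<Rightarrow> (nat \<Rightarrow> complex) \<Rightarrow> ennreal" where
  "d_norm p a =
     (if d_sum p a = \<infinity> then \<infinity> else ennreal (enn2real (d_sum p a) powr (1 / p)))"

definition d_space :: "real \<Rightarrow> (nat \<Rightarrow> complex) set" where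
  "d_space p = {a. d_norm p a < \<infinity>}"

definition convolution :: "(nat \<Rightarrow> complex) \<Rightarrow> (nat \<Rightarrow> complex) \<Rightarrow> nat \<Rightarrow> complex" where
  "convolution a b n = (\<Sum>j=0..n. a j * b (n - j))"

definition multipliers :: "(nat \<Rightarrow> complex) set \<Rightarrow> (nat \<Rightarrow> complex) set" where
  "multipliers X = {b. \<forall>a\<in>X. convolution a b \<in> X}"

lemma d_space_iff: "a \<in> d_space p \<longleftrightarrow> d_sum p a < \<infinity>"
  by (simp add: d_space_def d_norm_def less_top)

end

theory Submission
  imports Defs
begin

text \<open>
  The inclusion is an interpolation argument of Marcinkiewicz type. A sequence lies in
  \<open>d\<^sub>p\<close> iff \<open>\<bar>a\<^sub>n\<bar>\<^sup>p\<close> has a decreasing summable majorant \<open>\<beta>\<close>. Only the majorant matters for the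
  size of a convolution: the phases of \<open>a\<close> are free, so the largest possible value of
  \<open>\<bar>(a * b)\<^sub>k\<bar>\<close> under \<open>\<bar>a\<^sub>j\<bar>\<^sup>p \<le> \<beta>\<^sub>j\<close> is \<open>\<Sum>j\<le>k. \<beta>\<^sub>j\<^bsup>1/p\<^esup> \<bar>b\<^sub>k\<^sub>-\<^sub>j\<bar>\<close>. The weak-type condition
  \<open>weak_type p b\<close> bounds this quantity by a constant times the \<open>p\<close>-th root of the mean of
  \<open>\<beta>\<^sub>0, \<dots>, \<beta>\<^sub>k\<close>.

  Every multiplier \<open>b\<close> of \<open>d\<^sub>p\<close> satisfies this condition (\<open>multiplier_imp_weak_type\<close>). Since a
  sequence \<open>c\<close> in \<open>d\<^sub>p\<close> is \<open>O((k + 1)\<^bsup>-1/p\<^esup>)\<close>, a gliding hump in the phases of \<open>a\<close> bounds the sums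
  for each fixed \<open>\<beta>\<close>, and superposing a sequence of bad profiles \<open>\<beta>\<close> with weights \<open>2\<^bsup>-m\<^esup>\<close> shows
  that the bound is uniform. No cancellation is possible in the second step, because after
  the first one all terms are nonnegative.

  Conversely, weak type for an exponent \<open>r\<close> makes \<open>b\<close> a multiplier of \<open>d\<^sub>p\<close> for every \<open>p > r\<close>
  (\<open>weak_type_imp_multiplier\<close>): writing the majorant of \<open>\<bar>a\<^sub>n\<bar>\<^sup>p\<close> as \<open>\<delta>\<^bsup>p/r\<^esup>\<close>, the condition
  dominates \<open>\<bar>(a * b)\<^sub>k\<bar>\<^sup>p\<close> by the power \<open>p / r > 1\<close> of the means of \<open>\<delta>\<close>, which decrease, and are
  summable to that power by Hardy's inequality.

  Strictness uses the gap that this leaves. If \<open>\<Sum>n. \<bar>b\<^sub>n\<bar> (n + 1)\<^bsup>1/r\<^esup>\<close> converges then \<open>b\<close> has weak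
  type \<open>r\<close>, while each multiplier of \<open>d\<^sub>p\<close> belongs to \<open>d\<^sub>p\<close>, as the unit sequence does. For
  \<open>p\<^sub>1 < s < r < p\<^sub>2\<close> the sequence with the value \<open>n\<^bsup>-1/s\<^esup>\<close> at the powers of two and zero elsewhere
  is therefore a multiplier of \<open>d\<close> for \<open>p\<^sub>2\<close> and not for \<open>p\<^sub>1\<close>. Finally, \<open>d\<^sub>1\<close> is closed under
  convolution, so it consists of multipliers of itself, and the inclusions carry these to
  every \<open>p\<close>.
\<close>

section \<open>Decreasing majorants\<close>

definition decreasing_nonneg :: "(nat \<Rightarrow> real) \<Rightarrow> bool" where
  "decreasing_nonneg \<beta> \<longleftrightarrow> decseq \<beta> \<and> (\<forall>n. 0 \<le> \<beta> n)"

lemma decreasing_nonneg_sum_ge: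
  assumes "decreasing_nonneg \<beta>" "j \<le> k"
  shows "real (j + 1) * \<beta> j \<le> (\<Sum>i\<le>k. \<beta> i)"
proof -
  have "real (j + 1) * \<beta> j = (\<Sum>i\<le>j. \<beta> j)"
    by simp
  also have "\<dots> \<le> (\<Sum>i\<le>j. \<beta> i)"
    using assms(1) by (intro sum_mono) (auto simp: decreasing_nonneg_def decseq_def)
  also have "\<dots> \<le> (\<Sum>i\<le>k. \<beta> i)"
    using assms by (intro sum_mono2) (auto simp: decreasing_nonneg_def)
  finally show ?thesis .
qed

text \<open>
  The tail suprema that define the norm form the least decreasing majorant of \<open>\<bar>a\<^sub>n\<bar>\<^sup>p\<close>. With an
  arbitrary majorant in their place, membership in \<open>d\<^sub>p\<close> becomes a statement about real series
  without suprema.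
\<close>
lemma d_space_iff_majorant:
  "a \<in> d_space p \<longleftrightarrow>
     (\<exists>\<beta>. decreasing_nonneg \<beta> \<and> summable \<beta> \<and> (\<forall>n. cmod (a n) powr p \<le> \<beta> n))"
proof
  assume "a \<in> d_space p"
  then have fin: "(\<Sum>n. SUP k\<in>{n..}. ennreal (cmod (a k) powr p)) < \<infinity>"
    by (simp add: d_space_iff d_sum_def)
  define s where "s n = (SUP k\<in>{n..}. ennreal (cmod (a k) powr p))" for n
  define \<beta> where "\<beta> n = enn2real (s n)" for n
  have fin_s: "s n < \<infinity>" for n
    using sum_le_suminf[of s "{n}"] fin unfolding s_def by (auto simp: less_top intro: le_less_trans)
  then have s_eq: "s n = ennreal (\<beta> n)" for n
    by (simp add: \<beta>_def)
  have nonneg: "0 \<le> \<beta> n" for n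
    by (simp add: \<beta>_def)
  have "s n \<le> s m" if "m \<le> n" for m n
    unfolding s_def using that by (intro SUP_subset_mono) auto
  then have "decseq \<beta>"
    by (auto simp: decseq_def s_eq nonneg)
  moreover have "summable \<beta>"
    using fin by (intro summable_suminf_not_top nonneg) (simp add: s_def flip: s_eq)
  moreover have "cmod (a n) powr p \<le> \<beta> n" for n
  proof -
    have "ennreal (cmod (a n) powr p) \<le> s n"
      unfolding s_def by (intro SUP_upper) auto
    then show ?thesis
      by (simp add: s_eq nonneg)
  qed
  ultimately show "\<exists>\<beta>. decreasing_nonneg \<beta> \<and> summable \<beta> \<and> (\<forall>n. cmod (a n) powr p \<le> \<beta> n)"
    using nonneg by (auto simp: decreasing_nonneg_def)
next
  assume "\<exists>\<beta>. decreasing_nonneg \<beta> \<and> summable \<beta> \<and> (\<forall>n. cmod (a n) powr p \<le> \<beta> n)"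
  then obtain \<beta> where dec: "decseq \<beta>" and nonneg: "\<And>n. 0 \<le> \<beta> n" and sm: "summable \<beta>"
    and le: "\<And>n. cmod (a n) powr p \<le> \<beta> n"
    by (auto simp: decreasing_nonneg_def)
  have "cmod (a k) powr p \<le> \<beta> n" if "n \<le> k" for n k
    using le[of k] decseqD[OF dec that] by linarith
  then have "d_sum p a \<le> (\<Sum>n. ennreal (\<beta> n))"
    unfolding d_sum_def by (intro suminf_le SUP_least ennreal_leI) auto
  also have "\<dots> < \<infinity>"
    using sm nonneg by (simp add: suminf_ennreal2)
  finally show "a \<in> d_space p"
    by (simp add: d_space_iff)
qed

text \<open>
  A decreasing summable majorant satisfies \<open>(n + 1) \<beta>\<^sub>n \<le> \<Sum>i. \<beta>\<^sub>i\<close>. This pointwise decay is all that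
  the necessity proof below uses of the convolutions lying in \<open>d\<^sub>p\<close>.
\<close>
lemma d_space_weak_decay:
  assumes "a \<in> d_space p"
  obtains K where "\<And>n. real (n + 1) * cmod (a n) powr p \<le> K"
proof -
  from assms obtain \<beta> where dec: "decreasing_nonneg \<beta>" and sm: "summable \<beta>"
    and le: "\<And>n. cmod (a n) powr p \<le> \<beta> n"
    by (auto simp: d_space_iff_majorant)
  have "real (n + 1) * cmod (a n) powr p \<le> suminf \<beta>" for n
  proof -
    have "real (n + 1) * cmod (a n) powr p \<le> real (n + 1) * \<beta> n"
      using le by (intro mult_left_mono) auto
    also have "\<dots> \<le> (\<Sum>i\<le>n. \<beta> i)"
      using decreasing_nonneg_sum_ge[OF dec, of n n] by simp
    also have "\<dots> \<le> suminf \<beta>"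
      using dec sm by (intro sum_le_suminf) (auto simp: decreasing_nonneg_def)
    finally show ?thesis .
  qed
  then show thesis by (rule that)
qed

lemma cmod_convolution_le:
  assumes "\<And>j. j \<le> n \<Longrightarrow> cmod (a j) \<le> \<alpha> j"
  shows "cmod (convolution a b n) \<le> (\<Sum>j\<le>n. \<alpha> j * cmod (b (n - j)))"
  unfolding convolution_def atLeast0AtMost
  using assms by (intro sum_norm_le) (auto simp: norm_mult intro!: mult_right_mono)

section \<open>From multipliers to weak-type bounds\<close>

text \<open>
  The uniform boundedness principle for the functionals on \<open>\<ell>\<^sup>\<infinity>\<close> given by the rows of a lower
  triangular matrix. The proof is a gliding hump: along a sparse sequence of rows \<open>k\<^sub>m\<close> the
  vector \<open>u\<close> takes the conjugate phases of row \<open>k\<^sub>m\<close> on the block \<open>k\<^sub>m\<^sub>-\<^sub>1 < j \<le> k\<^sub>m\<close>. Triangularity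
  makes the later blocks invisible to that row, and the earlier ones contribute at most the
  sum of finitely many column bounds, which the choice of \<open>k\<^sub>m\<close> outweighs.
\<close>
lemma triangular_uniform_boundedness:
  fixes A :: "nat \<Rightarrow> nat \<Rightarrow> complex"
  assumes bdd: "\<And>u. (\<And>j. cmod (u j) \<le> 1) \<Longrightarrow> \<exists>K. \<forall>k. cmod (\<Sum>j\<le>k. A k j * u j) \<le> K"
  shows "\<exists>K. \<forall>k. (\<Sum>j\<le>k. cmod (A k j)) \<le> K"
proof (rule ccontr)
  define R where "R k = (\<Sum>j\<le>k. cmod (A k j))" for k
  assume "\<nexists>K. \<forall>k. (\<Sum>j\<le>k. cmod (A k j)) \<le> K"
  then have unbdd: "\<exists>k. R k > K" for K
    by (auto simp: R_def not_le)
  have R_nonneg: "0 \<le> R k" for k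
    by (simp add: R_def sum_nonneg)
  \<comment> \<open>The rows up to \<open>N\<close> have a common bound, so large row sums occur arbitrarily late.\<close>
  have large: "\<exists>k>N. R k > x" for N x
  proof -
    obtain k where k: "R k > max x (\<Sum>i\<le>N. R i)"
      using unbdd by blast
    have "R k \<le> (\<Sum>i\<le>N. R i)" if "k \<le> N"
      using that R_nonneg by (intro member_le_sum) auto
    with k show ?thesis
      by (intro exI[of _ k]) (auto simp: not_le[symmetric])
  qed
  \<comment> \<open>Unit vectors as test vectors bound the columns.\<close>
  have "\<exists>M. \<forall>k\<ge>j. cmod (A k j) \<le> M" for j
  proof -
    have "(\<Sum>i\<le>k. A k i * (if i = j then 1 else 0)) = A k j" if "j \<le> k" for k
      using that by (simp add: if_distrib cong: if_cong)
    moreover have "\<exists>M. \<forall>k. cmod (\<Sum>i\<le>k. A k i * (if i = j then 1 else 0)) \<le> M"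
      by (rule bdd) auto
    ultimately show ?thesis
      by metis
  qed
  then obtain M where M: "\<And>j k. j \<le> k \<Longrightarrow> cmod (A k j) \<le> M j"
    by metis
  \<comment> \<open>The factor 2 pays for the head of the row twice: it is missing from the hump, and its
     product with \<open>u\<close> may work against the hump.\<close>
  have "\<exists>k. \<forall>m. True \<and> (k m < k (Suc m) \<and> R (k (Suc m)) > real m + 2 * (\<Sum>j\<le>k m. M j))"
    by (rule dependent_nat_choice) (use large in auto)
  then obtain k where k_less: "\<And>m. k m < k (Suc m)"
    and R_gt: "\<And>m. R (k (Suc m)) > real m + 2 * (\<Sum>j\<le>k m. M j)"
    by blast
  have mono: "strict_mono k"
    using k_less by (simp add: strict_mono_Suc_iff)
  define u where "u j = cnj (sgn (A (k (LEAST m. j \<le> k m)) j))" for j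
  have u_le: "cmod (u j) \<le> 1" for j
    by (simp add: u_def norm_sgn)
  have row: "A (k (Suc m)) j * u j = of_real (cmod (A (k (Suc m)) j))"
    if "k m < j" "j \<le> k (Suc m)" for m j
  proof -
    have "(LEAST i. j \<le> k i) = Suc m"
    proof (rule Least_equality)
      show "Suc m \<le> i" if "j \<le> k i" for i
        using that \<open>k m < j\<close> strict_mono_less[OF mono, of m i] by linarith
    qed (use that in auto)
    moreover have "z * cnj (sgn z) = of_real (cmod z)" for z
      by (simp add: sgn_eq power2_eq_square flip: complex_norm_square)
    ultimately show ?thesis
      by (simp add: u_def)
  qed
  obtain K where K: "\<And>k. cmod (\<Sum>j\<le>k. A k j * u j) \<le> K"
    using bdd[of u] u_le by blast
  obtain m where m: "K < real m"
    using reals_Archimedean2 by blast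
  define k0 k1 where "k0 = k m" and "k1 = k (Suc m)"
  have k01: "k0 < k1"
    using k_less by (simp add: k0_def k1_def)
  have split: "{..k1} = {..k0} \<union> {k0<..k1}" "{..k0} \<inter> {k0<..k1} = {}"
    using k01 by auto
  have head: "(\<Sum>j\<le>k0. cmod (A k1 j)) \<le> (\<Sum>j\<le>k0. M j)"
    using k01 by (intro sum_mono M) auto
  have head_u: "cmod (\<Sum>j\<le>k0. A k1 j * u j) \<le> (\<Sum>j\<le>k0. cmod (A k1 j))"
    using u_le by (intro sum_norm_le) (auto simp: norm_mult intro!: mult_left_le)
  have tail: "(\<Sum>j\<in>{k0<..k1}. A k1 j * u j) = of_real (\<Sum>j\<in>{k0<..k1}. cmod (A k1 j))"
    using row by (simp add: k0_def k1_def)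
  have "(\<Sum>j\<le>k1. A k1 j * u j)
      = (\<Sum>j\<le>k0. A k1 j * u j) + of_real (\<Sum>j\<in>{k0<..k1}. cmod (A k1 j))"
    unfolding split(1) tail[symmetric] by (intro sum.union_disjoint) (use split in auto)
  then have "(\<Sum>j\<in>{k0<..k1}. cmod (A k1 j))
      = cmod ((\<Sum>j\<le>k1. A k1 j * u j) - (\<Sum>j\<le>k0. A k1 j * u j))"
    by (simp add: norm_of_real sum_nonneg del: of_real_sum)
  also have "\<dots> \<le> cmod (\<Sum>j\<le>k1. A k1 j * u j) + cmod (\<Sum>j\<le>k0. A k1 j * u j)"
    by (rule norm_triangle_ineq4)
  also have "\<dots> \<le> K + (\<Sum>j\<le>k0. M j)"
    using K[of k1] head head_u by linarith
  finally have "(\<Sum>j\<in>{k0<..k1}. cmod (A k1 j)) \<le> K + (\<Sum>j\<le>k0. M j)" .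
  moreover have "R k1 = (\<Sum>j\<le>k0. cmod (A k1 j)) + (\<Sum>j\<in>{k0<..k1}. cmod (A k1 j))"
    unfolding R_def split(1) by (intro sum.union_disjoint) (use split in auto)
  ultimately show False
    using R_gt[of m] head m by (simp add: k0_def k1_def)
qed

text \<open>
  For a fixed profile \<open>\<beta>\<close> every choice of phases \<open>u\<close> gives an element \<open>\<beta>\<^sub>j\<^bsup>1/p\<^esup> u\<^sub>j\<close> of \<open>d\<^sub>p\<close>. The decay
  of its convolution with \<open>b\<close> is boundedness of a triangular matrix on \<open>u\<close>, so the gliding hump
  puts absolute values inside the sum.
\<close>
lemma multiplier_bounded_on_profile:
  assumes p: "1 \<le> p" and b: "b \<in> multipliers (d_space p)"
    and dec: "decreasing_nonneg \<beta>" and sm: "summable \<beta>"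
  shows "\<exists>K. \<forall>k. real (k + 1) powr (1 / p) * (\<Sum>j\<le>k. \<beta> j powr (1 / p) * cmod (b (k - j))) \<le> K"
proof -
  define A where
    "A k j = of_real (real (k + 1) powr (1 / p) * \<beta> j powr (1 / p)) * b (k - j)" for k j
  have "\<exists>K. \<forall>k. (\<Sum>j\<le>k. cmod (A k j)) \<le> K"
  proof (rule triangular_uniform_boundedness)
    fix u :: "nat \<Rightarrow> complex" assume u: "\<And>j. cmod (u j) \<le> 1"
    define a where "a j = of_real (\<beta> j powr (1 / p)) * u j" for j
    have "cmod (a j) powr p \<le> \<beta> j" for j
    proof -
      have "cmod (a j) \<le> \<beta> j powr (1 / p)"
        using u by (auto simp: a_def norm_mult intro!: mult_left_le)
      then have "cmod (a j) powr p \<le> (\<beta> j powr (1 / p)) powr p"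
        using p by (intro powr_mono2) auto
      then show ?thesis
        using p dec by (simp add: powr_powr decreasing_nonneg_def)
    qed
    then have "a \<in> d_space p"
      using dec sm by (auto simp: d_space_iff_majorant)
    then have "convolution a b \<in> d_space p"
      using b by (simp add: multipliers_def)
    then obtain K where K: "\<And>n. real (n + 1) * cmod (convolution a b n) powr p \<le> K"
      by (rule d_space_weak_decay) blast
    have "cmod (\<Sum>j\<le>k. A k j * u j) \<le> K powr (1 / p)" for k
    proof -
      have "(\<Sum>j\<le>k. A k j * u j) = of_real (real (k + 1) powr (1 / p)) * convolution a b k"
        by (simp add: A_def a_def convolution_def atLeast0AtMost sum_distrib_left mult_ac)
      then have "cmod (\<Sum>j\<le>k. A k j * u j)
          = (real (k + 1) * cmod (convolution a b k) powr p) powr (1 / p)"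
        using p by (simp add: norm_mult powr_mult powr_powr del: of_nat_add)
      also have "\<dots> \<le> K powr (1 / p)"
        using p by (intro powr_mono2 K) auto
      finally show ?thesis .
    qed
    then show "\<exists>K. \<forall>k. cmod (\<Sum>j\<le>k. A k j * u j) \<le> K"
      by blast
  qed
  then show ?thesis
    by (simp add: A_def norm_mult sum_distrib_left mult_ac del: of_nat_add)
qed

text \<open>
  After optimising the phases of a sequence with \<open>\<bar>a\<^sub>j\<bar>\<^sup>p \<le> \<beta>\<^sub>j\<close> for \<open>j \<le> k\<close>, this is the weak-type
  estimate for convolution with \<open>b\<close>: the sequences \<open>c\<close> with \<open>\<bar>c\<^sub>k\<bar> = O((k + 1)\<^bsup>-1/p\<^esup>)\<close>, with their
  natural norm, take the place of \<open>d\<^sub>p\<close> as the target space.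
\<close>
definition weak_type :: "real \<Rightarrow> (nat \<Rightarrow> complex) \<Rightarrow> bool" where
  "weak_type p b \<longleftrightarrow> (\<exists>C. \<forall>\<beta> k. decreasing_nonneg \<beta> \<longrightarrow>
     real (k + 1) powr (1 / p) * (\<Sum>j\<le>k. \<beta> j powr (1 / p) * cmod (b (k - j)))
       \<le> C * (\<Sum>j\<le>k. \<beta> j) powr (1 / p))"

text \<open>
  If the constant cannot be chosen uniformly, there are profiles \<open>\<gamma>\<^sub>m\<close> of total mass one whose
  ratio exceeds \<open>m 2\<^sup>m\<close>. The profile \<open>\<delta> = \<Sum>m. 2\<^bsup>-m\<^esup> \<gamma>\<^sub>m\<close> is decreasing and summable and dominates each
  \<open>2\<^bsup>-m\<^esup> \<gamma>\<^sub>m\<close>, hence violates the bound for a single profile. Superposing the \<open>p\<close>-th powers of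
  sequences, rather than the sequences, makes the summability of \<open>\<delta>\<close> an exchange of sums, with
  no appeal to Minkowski's inequality.
\<close>
lemma multiplier_imp_weak_type:
  assumes p: "1 \<le> p" and b: "b \<in> multipliers (d_space p)"
  shows "weak_type p b"
proof (rule ccontr)
  define F where
    "F \<beta> k = real (k + 1) powr (1 / p) * (\<Sum>j\<le>k. \<beta> j powr (1 / p) * cmod (b (k - j)))"
    for \<beta> :: "nat \<Rightarrow> real" and k
  assume "\<not> weak_type p b"
  then have "\<exists>\<beta> k. decreasing_nonneg \<beta> \<and> F \<beta> k > (real m * 2 ^ m) * (\<Sum>j\<le>k. \<beta> j) powr (1 / p)"
    for m :: nat
    unfolding weak_type_def F_def by (meson not_le)
  then obtain \<beta> k where dec: "\<And>m. decreasing_nonneg (\<beta> m)"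
    and F_gt: "\<And>m. F (\<beta> m) (k m) > (real m * 2 ^ m) * (\<Sum>j\<le>k m. \<beta> m j) powr (1 / p)"
    by metis
  have nonneg: "0 \<le> \<beta> m j" for m j
    using dec by (auto simp: decreasing_nonneg_def)
  define \<sigma> where "\<sigma> m = (\<Sum>j\<le>k m. \<beta> m j)" for m
  \<comment> \<open>A profile of mass zero vanishes up to \<open>k\<close>, so both sides of the bound would be zero.\<close>
  have \<sigma>_pos: "\<sigma> m > 0" for m
  proof (rule ccontr)
    assume "\<not> \<sigma> m > 0"
    then have "(\<Sum>j\<le>k m. \<beta> m j) = 0"
      using sum_nonneg[of "{..k m}" "\<beta> m"] nonneg by (simp add: \<sigma>_def)
    then have "\<beta> m j = 0" if "j \<le> k m" for j
      using nonneg that by (subst (asm) sum_nonneg_eq_0_iff) auto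
    then have "F (\<beta> m) (k m) = 0" "\<sigma> m = 0"
      using p by (auto simp: F_def \<sigma>_def)
    with F_gt[of m] p show False
      by (simp add: \<sigma>_def)
  qed
  \<comment> \<open>Cutting off after \<open>k m\<close> keeps the profile decreasing and makes it summable.\<close>
  define \<gamma> where "\<gamma> m j = (if j \<le> k m then \<beta> m j / \<sigma> m else 0)" for m j
  have \<gamma>_nonneg: "0 \<le> \<gamma> m j" for m j
    using nonneg \<sigma>_pos[of m] by (simp add: \<gamma>_def)
  have \<gamma>_dec: "\<gamma> m j \<le> \<gamma> m i" if "i \<le> j" for m i j
    using dec[of m] that \<sigma>_pos[of m] nonneg
    by (auto simp: \<gamma>_def decreasing_nonneg_def decseq_def divide_right_mono)
  have \<gamma>_sum: "(\<Sum>j<N. \<gamma> m j) \<le> 1" for m N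
  proof -
    have "(\<Sum>j<N. \<gamma> m j) \<le> (\<Sum>j\<in>{..<N} \<union> {..k m}. \<gamma> m j)"
      using \<gamma>_nonneg by (intro sum_mono2) auto
    also have "\<dots> = (\<Sum>j\<le>k m. \<gamma> m j)"
      by (intro sum.mono_neutral_right) (auto simp: \<gamma>_def)
    also have "\<dots> = 1"
      using \<sigma>_pos[of m] by (simp add: \<gamma>_def flip: sum_divide_distrib) (simp add: \<sigma>_def)
    finally show ?thesis .
  qed
  have \<gamma>_le_1: "\<gamma> m j \<le> 1" for m j
    using \<gamma>_sum[of m "Suc j"] sum_nonneg[of "{..<j}" "\<gamma> m"] \<gamma>_nonneg by simp
  have geo: "summable (\<lambda>m. (1/2) ^ m :: real)"
    by (simp add: summable_geometric)
  have sm: "summable (\<lambda>m. (1/2) ^ m * \<gamma> m j)" for j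
    by (rule summable_comparison_test'[OF geo, of 0])
       (use \<gamma>_nonneg \<gamma>_le_1 in \<open>auto intro!: mult_left_le simp: abs_mult\<close>)
  define \<delta> where "\<delta> j = (\<Sum>m. (1/2) ^ m * \<gamma> m j)" for j
  have \<delta>_nonneg: "0 \<le> \<delta> j" for j
    unfolding \<delta>_def by (intro suminf_nonneg sm) (use \<gamma>_nonneg in auto)
  have "\<delta> j \<le> \<delta> i" if "i \<le> j" for i j
    unfolding \<delta>_def by (intro suminf_le sm) (use \<gamma>_dec[OF that] in auto)
  then have \<delta>_dec: "decreasing_nonneg \<delta>"
    using \<delta>_nonneg by (auto simp: decreasing_nonneg_def decseq_def)
  have \<delta>_sm: "summable \<delta>"
  proof (rule summableI_nonneg_bounded)
    show "(\<Sum>j<N. \<delta> j) \<le> (\<Sum>m. (1/2) ^ m)" for N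
    proof -
      have "(\<Sum>j<N. \<delta> j) = (\<Sum>m. \<Sum>j<N. (1/2) ^ m * \<gamma> m j)"
        unfolding \<delta>_def by (intro suminf_sum[symmetric] sm)
      also have "\<dots> \<le> (\<Sum>m. (1/2) ^ m)"
      proof (intro suminf_le summable_sum sm geo)
        show "(\<Sum>j<N. (1/2) ^ m * \<gamma> m j) \<le> (1/2) ^ m" for m
          using \<gamma>_sum[of m N] by (simp add: mult_left_le flip: sum_distrib_left)
      qed
      finally show ?thesis .
    qed
  qed (rule \<delta>_nonneg)
  obtain K where K: "\<And>k. F \<delta> k \<le> K"
    using multiplier_bounded_on_profile[OF p b \<delta>_dec \<delta>_sm] unfolding F_def by blast
  have "real m \<le> K" for m
  proof -
    have \<beta>_le: "(1/2) ^ m * \<beta> m j powr (1 / p) \<le> \<sigma> m powr (1 / p) * \<delta> j powr (1 / p)"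
      if "j \<le> k m" for j
    proof -
      have "(1/2) ^ m * \<gamma> m j \<le> \<delta> j"
        unfolding \<delta>_def using sum_le_suminf[OF sm, of "{m}"] \<gamma>_nonneg by simp
      then have "(1/2) ^ m * \<beta> m j \<le> \<sigma> m * \<delta> j"
        using that \<sigma>_pos[of m] by (simp add: \<gamma>_def field_simps)
      then have "((1/2) ^ m * \<beta> m j) powr (1 / p) \<le> (\<sigma> m * \<delta> j) powr (1 / p)"
        using p nonneg by (intro powr_mono2) auto
      \<comment> \<open>Since \<open>p \<ge> 1\<close>, the root only increases the weight \<open>2\<^bsup>-m\<^esup>\<close>.\<close>
      moreover have "((1/2) ^ m :: real) powr 1 \<le> ((1/2) ^ m) powr (1 / p)"
        using p by (intro powr_mono') (auto simp: power_le_one)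
      then have "(1/2) ^ m * \<beta> m j powr (1 / p) \<le> ((1/2) ^ m) powr (1 / p) * \<beta> m j powr (1 / p)"
        by (intro mult_right_mono) auto
      ultimately show ?thesis
        using nonneg \<sigma>_pos[of m] \<delta>_nonneg by (simp add: powr_mult)
    qed
    have "(1/2) ^ m * F (\<beta> m) (k m)
        = real (k m + 1) powr (1 / p)
          * (\<Sum>j\<le>k m. (1/2) ^ m * \<beta> m j powr (1 / p) * cmod (b (k m - j)))"
      by (simp add: F_def sum_distrib_left mult_ac del: of_nat_add)
    also have "\<dots> \<le> real (k m + 1) powr (1 / p)
          * (\<Sum>j\<le>k m. \<sigma> m powr (1 / p) * \<delta> j powr (1 / p) * cmod (b (k m - j)))"
      by (intro mult_left_mono sum_mono mult_right_mono \<beta>_le) auto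
    also have "\<dots> = \<sigma> m powr (1 / p) * F \<delta> (k m)"
      by (simp add: F_def sum_distrib_left mult_ac del: of_nat_add)
    also have "\<dots> \<le> \<sigma> m powr (1 / p) * K"
      by (intro mult_left_mono K) auto
    finally have "F (\<beta> m) (k m) \<le> 2 ^ m * (\<sigma> m powr (1 / p) * K)"
      by (simp add: power_one_over field_simps)
    from less_le_trans[OF F_gt this]
    have "real m * (2 ^ m * \<sigma> m powr (1 / p)) < K * (2 ^ m * \<sigma> m powr (1 / p))"
      by (simp only: \<sigma>_def mult_ac)
    then have "real m < K"
      using mult_right_less_imp_less[of "real m" "2 ^ m * \<sigma> m powr (1 / p)" K] by simp
    then show ?thesis by simp
  qed
  then show False
    using reals_Archimedean2[of K] by (auto simp: not_le[symmetric])
qed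


section \<open>Hardy's inequality and interpolation\<close>

definition mean :: "(nat \<Rightarrow> real) \<Rightarrow> nat \<Rightarrow> real" where
  "mean x n = (\<Sum>j\<le>n. x j) / real (n + 1)"

lemma mean_nonneg: "(\<And>n. 0 \<le> x n) \<Longrightarrow> 0 \<le> mean x n"
  by (simp add: mean_def sum_nonneg)

lemma mean_recurrence: "real (n + 1) * mean x n = real n * mean x (n - 1) + x n"
  by (cases n) (auto simp: mean_def field_simps)

lemma decseq_mean:
  assumes "decseq x"
  shows "decseq (mean x)"
proof (rule decseq_SucI)
  fix n
  have "x (Suc n) * real (n + 1) = (\<Sum>j\<le>n. x (Suc n))"
    by simp
  also have "\<dots> \<le> (\<Sum>j\<le>n. x j)"
    using assms by (intro sum_mono) (auto simp: decseq_def)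
  finally have "x (Suc n) * real (n + 1) \<le> (\<Sum>j\<le>n. x j)" .
  then show "mean x (Suc n) \<le> mean x n"
    by (simp add: mean_def field_simps)
qed

text \<open>
  Elliott's step in the proof of Hardy's inequality: the right-hand side telescopes. Replacing
  \<open>x\<^sub>n\<close> by the difference of \<open>(n + 1) mean\<^sub>n\<close> and \<open>n mean\<^sub>n\<^sub>-\<^sub>1\<close> leaves one mixed product of the two means,
  to which Young's inequality applies. At \<open>n = 0\<close> the term \<open>mean\<^sub>n\<^sub>-\<^sub>1\<close> has the coefficient zero, so
  truncated subtraction does no harm.
\<close>
lemma Hardy_pointwise:
  assumes q: "1 < q" and x: "\<And>n. 0 \<le> x n"
  shows "(q - 1) * mean x n powr q - q * (mean x n powr (q - 1) * x n)
           \<le> real n * mean x (n - 1) powr q - real (n + 1) * mean x n powr q"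
proof -
  define H G where "H = mean x n" and "G = mean x (n - 1)"
  have nonneg: "0 \<le> H" "0 \<le> G"
    using x by (simp_all add: H_def G_def mean_nonneg)
  have HH: "H powr q = H powr (q - 1) * H"
    using nonneg(1) by (cases "H = 0") (simp_all add: powr_diff)
  have "H powr (q - 1) * G
      \<le> (H powr (q - 1)) powr (q / (q - 1)) / (q / (q - 1)) + G powr q / q"
    using q nonneg by (intro Youngs_inequality) (auto simp: field_simps)
  also have "(H powr (q - 1)) powr (q / (q - 1)) = H powr q"
    using q by (simp add: powr_powr)
  finally have "q * (H powr (q - 1) * G) \<le> (q - 1) * H powr q + G powr q"
    using q by (simp add: field_simps)
  then have "real n * (q * (H powr (q - 1) * G)) \<le> real n * ((q - 1) * H powr q + G powr q)"
    by (intro mult_left_mono) auto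
  moreover have x_eq: "x n = real (n + 1) * H - real n * G"
    using mean_recurrence[of n x] by (simp add: H_def G_def)
  ultimately show ?thesis
    unfolding H_def[symmetric] G_def[symmetric] HH x_eq by (simp add: algebra_simps)
qed

lemma Hardy_sum_mixed:
  assumes q: "1 < q" and x: "\<And>n. 0 \<le> x n"
  shows "(q - 1) * (\<Sum>n<N. mean x n powr q) \<le> q * (\<Sum>n<N. mean x n powr (q - 1) * x n)"
proof -
  have "(q - 1) * (\<Sum>n<N. mean x n powr q) - q * (\<Sum>n<N. mean x n powr (q - 1) * x n)
      \<le> - real N * mean x (N - 1) powr q"
  proof (induction N)
    case (Suc N)
    then show ?case
      using Hardy_pointwise[of q x N, OF q x] by (simp add: algebra_simps)
  qed simp
  also have "\<dots> \<le> 0"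
    by simp
  finally show ?thesis
    by simp
qed

text \<open>
  The qualitative form of Hardy's inequality. In place of Hoelder's inequality, each mixed
  term is estimated according to whether \<open>x\<^sub>n\<close> is smaller than \<open>\<epsilon>\<close> times the mean. The factor
  \<open>\<epsilon> = (q - 1) / (2 q)\<close> is chosen so that half of the left-hand side absorbs the sum of the
  powers of the means.
\<close>
lemma Hardy_summable:
  assumes q: "1 < q" and x: "\<And>n. 0 \<le> x n" and sm: "summable (\<lambda>n. x n powr q)"
  shows "summable (\<lambda>n. mean x n powr q)"
proof -
  define \<epsilon> where "\<epsilon> = (q - 1) / (2 * q)"
  have \<epsilon>: "\<epsilon> > 0"
    using q by (simp add: \<epsilon>_def)
  define D where "D = (1 / \<epsilon>) powr (q - 1)"
  have split: "mean x n powr (q - 1) * x n \<le> \<epsilon> * mean x n powr q + D * x n powr q" for n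
  proof (cases "x n \<le> \<epsilon> * mean x n")
    case True
    have "mean x n powr (q - 1) * x n \<le> mean x n powr (q - 1) * (\<epsilon> * mean x n)"
      using True by (intro mult_left_mono) auto
    also have "\<dots> = \<epsilon> * mean x n powr q"
      using mean_nonneg[of x n, OF x] by (cases "mean x n = 0") (auto simp: powr_diff)
    finally show ?thesis
      by (simp add: D_def add_increasing2)
  next
    case False
    then have "mean x n \<le> (1 / \<epsilon>) * x n"
      using \<epsilon> by (simp add: field_simps)
    then have "mean x n powr (q - 1) \<le> ((1 / \<epsilon>) * x n) powr (q - 1)"
      using mean_nonneg[of x n, OF x] q by (intro powr_mono2) auto
    also have "\<dots> = D * x n powr (q - 1)"
      unfolding D_def by (rule powr_mult)
    finally have "mean x n powr (q - 1) * x n \<le> D * x n powr (q - 1) * x n"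
      using x by (intro mult_right_mono) auto
    also have "\<dots> = D * x n powr q"
      using x[of n] by (cases "x n = 0") (auto simp: powr_diff)
    finally show ?thesis
      using \<epsilon> by (simp add: add_increasing)
  qed
  show ?thesis
  proof (rule summableI_nonneg_bounded)
    fix N
    let ?S = "\<Sum>n<N. mean x n powr q"
    have "(q - 1) * ?S \<le> q * (\<Sum>n<N. mean x n powr (q - 1) * x n)"
      by (rule Hardy_sum_mixed[of q x, OF q x])
    also have "\<dots> \<le> q * (\<Sum>n<N. \<epsilon> * mean x n powr q + D * x n powr q)"
      using q by (intro mult_left_mono sum_mono split) auto
    also have "(\<Sum>n<N. \<epsilon> * mean x n powr q + D * x n powr q)
        = \<epsilon> * ?S + D * (\<Sum>n<N. x n powr q)"
      by (simp add: sum.distrib sum_distrib_left)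
    also have "q * \<dots> = (q - 1) / 2 * ?S + q * D * (\<Sum>n<N. x n powr q)"
      using q by (simp add: \<epsilon>_def distrib_left)
    finally have "(q - 1) * ?S \<le> (q - 1) / 2 * ?S + q * D * (\<Sum>n<N. x n powr q)" .
    moreover have "q * D * (\<Sum>n<N. x n powr q) \<le> q * D * (\<Sum>n. x n powr q)"
      using q by (intro mult_left_mono sum_le_suminf sm) (auto simp: D_def)
    ultimately have "(q - 1) / 2 * ?S \<le> q * D * (\<Sum>n. x n powr q)"
      by simp
    then show "?S \<le> 2 * q * D * (\<Sum>n. x n powr q) / (q - 1)"
      using q by (simp add: field_simps)
  qed simp
qed

text \<open>
  With \<open>q = p / r\<close> and \<open>\<delta> = \<beta>\<^bsup>1/q\<^esup>\<close>, a majorant \<open>\<beta>\<close> of \<open>\<bar>a\<^sub>n\<bar>\<^sup>p\<close> gives the majorant \<open>\<delta>\<close> of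
  \<open>\<bar>a\<^sub>n\<bar>\<^sup>r\<close>. The latter need not be summable, but its means are defined, and the weak-type
  bound turns their \<open>q\<close>-th power into a majorant of \<open>\<bar>(a * b)\<^sub>n\<bar>\<^sup>p\<close>, up to a constant. Hardy's
  inequality is available because \<open>q > 1\<close>, which is where \<open>r < p\<close> enters.
\<close>
lemma weak_type_imp_multiplier:
  assumes r: "0 < r" "r < p" and wt: "weak_type r b"
  shows "b \<in> multipliers (d_space p)"
  unfolding multipliers_def
proof (intro CollectI ballI)
  fix a assume "a \<in> d_space p"
  then obtain \<beta> where dec: "decseq \<beta>" and nonneg: "\<And>n. 0 \<le> \<beta> n" and sm: "summable \<beta>"
    and le: "\<And>n. cmod (a n) powr p \<le> \<beta> n"
    by (auto simp: d_space_iff_majorant decreasing_nonneg_def)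
  obtain C0 where C0: "\<And>\<beta> k. decreasing_nonneg \<beta> \<Longrightarrow>
     real (k + 1) powr (1 / r) * (\<Sum>j\<le>k. \<beta> j powr (1 / r) * cmod (b (k - j)))
       \<le> C0 * (\<Sum>j\<le>k. \<beta> j) powr (1 / r)"
    using wt unfolding weak_type_def by blast
  \<comment> \<open>Raising the bound to the power \<open>p\<close> requires a nonnegative constant.\<close>
  define C where "C = max C0 0"
  define q where "q = p / r"
  have q: "1 < q" and p: "0 < p"
    using r by (auto simp: q_def)
  define \<delta> where "\<delta> n = \<beta> n powr (1 / q)" for n
  have \<delta>_nonneg: "0 \<le> \<delta> n" for n
    by (simp add: \<delta>_def)
  have \<delta>_dec: "decseq \<delta>"
    using dec nonneg q by (auto simp: \<delta>_def decseq_def intro!: powr_mono2)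
  have \<delta>_q: "\<delta> n powr q = \<beta> n" for n
    using q nonneg by (simp add: \<delta>_def powr_powr)
  have a_le: "cmod (a n) \<le> \<delta> n powr (1 / r)" for n
  proof -
    have "(cmod (a n) powr p) powr (1 / p) \<le> \<beta> n powr (1 / p)"
      using p by (intro powr_mono2 le) auto
    then show ?thesis
      using p r by (simp add: powr_powr \<delta>_def q_def)
  qed
  have conv_le: "cmod (convolution a b k) \<le> C * mean \<delta> k powr (1 / r)" for k
  proof -
    let ?T = "\<Sum>j\<le>k. \<delta> j powr (1 / r) * cmod (b (k - j))"
    have "real (k + 1) powr (1 / r) * ?T \<le> C0 * (\<Sum>j\<le>k. \<delta> j) powr (1 / r)"
      using \<delta>_dec \<delta>_nonneg by (intro C0) (auto simp: decreasing_nonneg_def)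
    also have "\<dots> \<le> C * (\<Sum>j\<le>k. \<delta> j) powr (1 / r)"
      by (intro mult_right_mono) (auto simp: C_def)
    also have "(\<Sum>j\<le>k. \<delta> j) = real (k + 1) * mean \<delta> k"
      by (simp add: mean_def)
    finally have "real (k + 1) powr (1 / r) * ?T
        \<le> real (k + 1) powr (1 / r) * (C * mean \<delta> k powr (1 / r))"
      by (simp add: powr_mult mult_ac del: of_nat_add)
    then have "?T \<le> C * mean \<delta> k powr (1 / r)"
      by (simp del: of_nat_add)
    with cmod_convolution_le[of k a "\<lambda>j. \<delta> j powr (1 / r)" b] a_le show ?thesis
      by fastforce
  qed
  define \<eta> where "\<eta> n = C powr p * mean \<delta> n powr q" for n
  have "cmod (convolution a b n) powr p \<le> \<eta> n" for n
  proof -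
    have "cmod (convolution a b n) powr p \<le> (C * mean \<delta> n powr (1 / r)) powr p"
      using p by (intro powr_mono2 conv_le) auto
    then show ?thesis
      by (simp add: \<eta>_def powr_mult powr_powr q_def C_def)
  qed
  moreover have "decreasing_nonneg \<eta>"
    using decseq_mean[OF \<delta>_dec] mean_nonneg[of \<delta>, OF \<delta>_nonneg] q
    by (auto simp: decreasing_nonneg_def decseq_def \<eta>_def intro!: mult_left_mono powr_mono2)
  moreover have "summable \<eta>"
    unfolding \<eta>_def using Hardy_summable[of q \<delta>, OF q \<delta>_nonneg] sm by (simp add: \<delta>_q summable_mult)
  ultimately show "convolution a b \<in> d_space p"
    by (auto simp: d_space_iff_majorant)
qed

section \<open>A multiplier separating two exponents\<close>

text \<open>
  A single unit mass at \<open>n\<close> shifts a profile by \<open>n\<close>, which costs at most the factor \<open>n + 1\<close> in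
  \<open>(k + 1) \<beta>\<^sub>k\<^sub>-\<^sub>n\<close>, because \<open>k + 1 \<le> (n + 1) (k - n + 1)\<close> and \<open>(j + 1) \<beta>\<^sub>j\<close> is at most the sum of
  the profile. The estimates for the individual masses add up to the weighted sum.
\<close>
lemma weighted_summable_imp_weak_type:
  assumes r: "0 < r" and sm: "summable (\<lambda>n. cmod (b n) * real (n + 1) powr (1 / r))"
  shows "weak_type r b"
  unfolding weak_type_def
proof (intro exI allI impI)
  fix \<beta> :: "nat \<Rightarrow> real" and k assume dec: "decreasing_nonneg \<beta>"
  define w where "w n = cmod (b n) * real (n + 1) powr (1 / r)" for n
  define S where "S = (\<Sum>j\<le>k. \<beta> j)"
  have S: "0 \<le> S"
    using dec by (auto simp: S_def decreasing_nonneg_def intro: sum_nonneg)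
  have term_le: "real (k + 1) powr (1 / r) * (\<beta> j powr (1 / r) * cmod (b (k - j)))
      \<le> S powr (1 / r) * w (k - j)" if "j \<le> k" for j
  proof -
    have "k + 1 \<le> (k - j + 1) * (j + 1)"
      using le_Suc_ex[OF that] by auto
    then have "real (k + 1) * \<beta> j \<le> real ((k - j + 1) * (j + 1)) * \<beta> j"
      using dec by (intro mult_right_mono of_nat_mono) (auto simp: decreasing_nonneg_def)
    also have "\<dots> = real (k - j + 1) * (real (j + 1) * \<beta> j)"
      by (simp only: of_nat_mult mult.assoc)
    also have "\<dots> \<le> real (k - j + 1) * S"
      unfolding S_def using decreasing_nonneg_sum_ge[OF dec that] by (intro mult_left_mono) auto
    finally have "(real (k + 1) * \<beta> j) powr (1 / r) \<le> (real (k - j + 1) * S) powr (1 / r)"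
      using dec r by (intro powr_mono2) (auto simp: decreasing_nonneg_def)
    then have "real (k + 1) powr (1 / r) * \<beta> j powr (1 / r)
        \<le> real (k - j + 1) powr (1 / r) * S powr (1 / r)"
      by (simp add: powr_mult del: of_nat_add)
    from mult_right_mono[OF this, of "cmod (b (k - j))"] show ?thesis
      by (simp add: w_def mult_ac del: of_nat_add)
  qed
  have "real (k + 1) powr (1 / r) * (\<Sum>j\<le>k. \<beta> j powr (1 / r) * cmod (b (k - j)))
      \<le> (\<Sum>j\<le>k. S powr (1 / r) * w (k - j))"
    unfolding sum_distrib_left by (intro sum_mono term_le) auto
  also have "\<dots> = S powr (1 / r) * (\<Sum>j\<le>k. w j)"
    unfolding sum_distrib_left[symmetric]
    by (intro arg_cong2[where f = "(*)"] refl
        sum.reindex_bij_witness[where i = "\<lambda>j. k - j" and j = "\<lambda>j. k - j"]) auto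
  also have "\<dots> \<le> S powr (1 / r) * suminf w"
    using sm by (intro mult_left_mono sum_le_suminf) (auto simp: w_def[abs_def])
  finally show "real (k + 1) powr (1 / r) * (\<Sum>j\<le>k. \<beta> j powr (1 / r) * cmod (b (k - j)))
      \<le> suminf w * (\<Sum>j\<le>k. \<beta> j) powr (1 / r)"
    by (simp add: S_def mult_ac)
qed

lemma multipliers_subset_d_space: "multipliers (d_space p) \<subseteq> d_space p"
proof
  fix b assume b: "b \<in> multipliers (d_space p)"
  define e :: "nat \<Rightarrow> complex" where "e n = (if n = 0 then 1 else 0)" for n
  define \<beta> :: "nat \<Rightarrow> real" where "\<beta> n = (if n = 0 then 1 else 0)" for n
  have "decreasing_nonneg \<beta>" "summable \<beta>" "cmod (e n) powr p \<le> \<beta> n" for n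
    by (auto simp: decreasing_nonneg_def decseq_def \<beta>_def[abs_def] e_def summable_single)
  then have "e \<in> d_space p"
    unfolding d_space_iff_majorant by blast
  then have "convolution e b \<in> d_space p"
    using b by (simp add: multipliers_def)
  moreover have "convolution e b = b"
  proof
    show "convolution e b n = b n" for n
      unfolding convolution_def e_def by (subst sum.remove[of _ 0]) auto
  qed
  ultimately show "b \<in> d_space p"
    by simp
qed

text \<open>
  For \<open>p < s < r\<close> the value \<open>n\<^bsup>-1/s\<^esup>\<close> at infinitely many places \<open>n\<close> decays too slowly for \<open>d\<^sub>p\<close>. At
  the powers of two, the weighted sum for the exponent \<open>r\<close> is essentially a geometric series
  with ratio \<open>2\<^bsup>1/r - 1/s\<^esup> < 1\<close>.
\<close>
lemma exists_weak_type_not_in_d_space: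
  assumes p: "0 < p" "p < r"
  obtains b where "weak_type r b" "b \<notin> d_space p"
proof -
  obtain s where s: "p < s" "s < r"
    using dense[OF p(2)] by blast
  define b :: "nat \<Rightarrow> complex" where
    "b n = (if n \<in> range ((^) 2) then of_real (real n powr (- 1 / s)) else 0)" for n
  have b_pow: "cmod (b (2 ^ i)) = (2 ^ i) powr (- 1 / s)" for i
    by (simp add: b_def)
  have "summable (\<lambda>i. cmod (b (2 ^ i)) * real (2 ^ i + 1) powr (1 / r))"
  proof (rule summable_comparison_test')
    have "2 powr (1 / r - 1 / s) < (1 :: real)"
      using p s by (simp add: powr_less_one frac_less2)
    then show "summable (\<lambda>i. 2 powr (1 / r) * (2 powr (1 / r - 1 / s)) ^ i :: real)"
      by (intro summable_mult summable_geometric) auto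
  next
    fix i :: nat
    have "real (2 ^ i + 1) powr (1 / r) \<le> (2 * 2 ^ i) powr (1 / r)"
      using p s by (intro powr_mono2) auto
    then have "(2 ^ i) powr (- 1 / s) * real (2 ^ i + 1) powr (1 / r)
        \<le> (2 ^ i) powr (- 1 / s) * (2 * 2 ^ i) powr (1 / r)"
      by (intro mult_left_mono) auto
    also have "\<dots> = 2 powr (1 / r) * (2 powr (1 / r - 1 / s)) ^ i"
      by (simp add: powr_mult powr_powr algebra_simps diff_divide_distrib
          flip: powr_realpow powr_add)
    finally show "norm (cmod (b (2 ^ i)) * real (2 ^ i + 1) powr (1 / r))
        \<le> 2 powr (1 / r) * (2 powr (1 / r - 1 / s)) ^ i"
      by (simp add: b_pow)
  qed
  then have "summable (\<lambda>n. cmod (b n) * real (n + 1) powr (1 / r))"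
    by (subst summable_mono_reindex[of "(^) 2", symmetric])
       (auto simp: strict_mono_def b_def)
  then have "weak_type r b"
    using p by (intro weighted_summable_imp_weak_type) auto
  moreover have "b \<notin> d_space p"
  proof
    assume "b \<in> d_space p"
    then obtain K where K: "\<And>n. real (n + 1) * cmod (b n) powr p \<le> K"
      by (rule d_space_weak_decay) blast
    have "(2 powr (1 - p / s)) ^ i \<le> K" for i
    proof -
      have "(2 powr (1 - p / s)) ^ i = 2 ^ i * cmod (b (2 ^ i)) powr p"
        by (simp add: b_pow powr_powr algebra_simps diff_divide_distrib
            flip: powr_realpow powr_add)
      also have "\<dots> \<le> real (2 ^ i + 1) * cmod (b (2 ^ i)) powr p"
        by (intro mult_right_mono) auto
      also have "\<dots> \<le> K"
        by (rule K)
      finally show ?thesis .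
    qed
    moreover have "1 < 2 powr (1 - p / s)"
      using p s by (simp add: gr_one_powr)
    then obtain i where "K < (2 powr (1 - p / s)) ^ i"
      using real_arch_pow by blast
    ultimately show False
      by (simp add: not_le[symmetric])
  qed
  ultimately show thesis
    by (rule that)
qed

section \<open>The convolution algebra for exponent one\<close>

text \<open>
  In each product \<open>a\<^sub>j b\<^sub>n\<^sub>-\<^sub>j\<close> one of the two indices is at least \<open>n div 2\<close>, so one of the factors is
  bounded by its majorant there, while the other one is summed. Sampling a decreasing summable
  sequence at \<open>n div 2\<close> only doubles its sum.
\<close>
lemma d_space_one_convolution:
  assumes "a \<in> d_space 1" "b \<in> d_space 1"
  shows "convolution a b \<in> d_space 1"
proof -
  from assms obtain \<alpha> \<beta> where dec: "decseq \<alpha>" "decseq \<beta>"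
    and nonneg: "\<And>n. 0 \<le> \<alpha> n" "\<And>n. 0 \<le> \<beta> n" and sm: "summable \<alpha>" "summable \<beta>"
    and le: "\<And>n. cmod (a n) \<le> \<alpha> n" "\<And>n. cmod (b n) \<le> \<beta> n"
    by (auto simp: d_space_iff_majorant decreasing_nonneg_def)
  define \<gamma> where "\<gamma> n = suminf \<alpha> * \<beta> (n div 2) + suminf \<beta> * \<alpha> (n div 2)" for n
  have half: "summable (\<lambda>n. x (n div 2))" if "summable x" "\<And>n. 0 \<le> x n" for x :: "nat \<Rightarrow> real"
  proof (rule summableI_nonneg_bounded)
    show "(\<Sum>n<N. x (n div 2)) \<le> 2 * suminf x" for N
    proof -
      have "(\<Sum>n<N. x (n div 2)) \<le> (\<Sum>n<2 * N. x (n div 2))"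
        using that by (intro sum_mono2) auto
      also have "\<dots> = 2 * (\<Sum>n<N. x n)"
        by (induction N) auto
      also have "\<dots> \<le> 2 * suminf x"
        using that by (intro mult_left_mono sum_le_suminf) auto
      finally show ?thesis .
    qed
  qed (use that in auto)
  have part: "(\<Sum>j\<le>n. x j) \<le> suminf x" if "summable x" "\<And>n. 0 \<le> x n"
    for x :: "nat \<Rightarrow> real" and n
    using that by (intro sum_le_suminf) auto
  have "cmod (convolution a b n) \<le> \<gamma> n" for n
  proof -
    have "cmod (convolution a b n) \<le> (\<Sum>j\<le>n. \<alpha> j * cmod (b (n - j)))"
      by (intro cmod_convolution_le le)
    also have "\<dots> \<le> (\<Sum>j\<le>n. \<alpha> j * \<beta> (n div 2) + \<beta> (n - j) * \<alpha> (n div 2))"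
    proof (rule sum_mono)
      fix j assume "j \<in> {..n}"
      have "\<alpha> j * \<beta> (n - j) \<le> \<alpha> j * \<beta> (n div 2) + \<beta> (n - j) * \<alpha> (n div 2)"
      proof (cases "j \<le> n div 2")
        case True
        then have "\<beta> (n - j) \<le> \<beta> (n div 2)"
          by (intro decseqD[OF dec(2)]) linarith
        then have "\<alpha> j * \<beta> (n - j) \<le> \<alpha> j * \<beta> (n div 2)"
          using nonneg by (intro mult_left_mono) auto
        then show ?thesis
          using nonneg by (simp add: add_increasing2)
      next
        case False
        then have "\<alpha> j \<le> \<alpha> (n div 2)"
          by (intro decseqD[OF dec(1)]) linarith
        then have "\<beta> (n - j) * \<alpha> j \<le> \<beta> (n - j) * \<alpha> (n div 2)"
          using nonneg by (intro mult_left_mono) auto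
        then show ?thesis
          using nonneg by (simp add: add_increasing mult.commute)
      qed
      moreover have "\<alpha> j * cmod (b (n - j)) \<le> \<alpha> j * \<beta> (n - j)"
        using nonneg le by (intro mult_left_mono) auto
      ultimately show "\<alpha> j * cmod (b (n - j)) \<le> \<alpha> j * \<beta> (n div 2) + \<beta> (n - j) * \<alpha> (n div 2)"
        by linarith
    qed
    also have "\<dots> = (\<Sum>j\<le>n. \<alpha> j) * \<beta> (n div 2) + (\<Sum>j\<le>n. \<beta> (n - j)) * \<alpha> (n div 2)"
      by (simp add: sum.distrib sum_distrib_right)
    also have "(\<Sum>j\<le>n. \<beta> (n - j)) = (\<Sum>j\<le>n. \<beta> j)"
      by (rule sum.reindex_bij_witness[where i = "\<lambda>j. n - j" and j = "\<lambda>j. n - j"]) auto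
    also have "(\<Sum>j\<le>n. \<alpha> j) * \<beta> (n div 2) + (\<Sum>j\<le>n. \<beta> j) * \<alpha> (n div 2) \<le> \<gamma> n"
      unfolding \<gamma>_def using nonneg sm by (intro add_mono mult_right_mono part) auto
    finally show ?thesis .
  qed
  moreover have "decreasing_nonneg \<gamma>"
    unfolding decreasing_nonneg_def decseq_def \<gamma>_def using nonneg sm
    by (auto intro!: add_mono mult_left_mono decseqD[OF dec(1)] decseqD[OF dec(2)] suminf_nonneg
        add_nonneg_nonneg mult_nonneg_nonneg div_le_mono)
  moreover have "summable \<gamma>"
    unfolding \<gamma>_def using nonneg sm by (intro summable_add summable_mult half) auto
  ultimately show ?thesis
    by (auto simp: d_space_iff_majorant)
qed

section \<open>The strict chain of multiplier algebras\<close>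

theorem theorem4p5:
  shows "(\<forall>p1 p2 :: real. 1 \<le> p1 \<and> p1 < p2 \<longrightarrow>
            multipliers (d_space p1) \<subset> multipliers (d_space p2)) \<and>
         (\<forall>p :: real. 1 \<le> p \<longrightarrow> d_space 1 \<subseteq> multipliers (d_space p))"
proof -
  have subset: "multipliers (d_space p1) \<subseteq> multipliers (d_space p2)"
    if "1 \<le> p1" "p1 < p2" for p1 p2 :: real
    using that multiplier_imp_weak_type[of p1] weak_type_imp_multiplier[of p1 p2] by auto
  have strict: "multipliers (d_space p1) \<subset> multipliers (d_space p2)"
    if p12: "1 \<le> p1" "p1 < p2" for p1 p2 :: real
  proof -
    obtain r where r: "p1 < r" "r < p2"
      using dense[OF p12(2)] by blast
    obtain b where b: "weak_type r b" "b \<notin> d_space p1"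
      using exists_weak_type_not_in_d_space[of p1 r] p12 r by auto
    have "b \<in> multipliers (d_space p2)"
      using weak_type_imp_multiplier[of r p2 b] b p12 r by auto
    moreover have "b \<notin> multipliers (d_space p1)"
      using b multipliers_subset_d_space by blast
    ultimately show ?thesis
      using subset[OF p12] by blast
  qed
  have "d_space 1 \<subseteq> multipliers (d_space 1)"
    by (auto simp: multipliers_def intro: d_space_one_convolution)
  then have "d_space 1 \<subseteq> multipliers (d_space p)" if "1 \<le> p" for p :: real
    using subset[of 1 p] that by (cases "p = 1") auto
  with strict show ?thesis
    by blast
qed

end
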